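(* Let $F_2(x)=\sum_{n=1}^\infty \frac{\sigma_1(n)}{n^3}\sin(2\pi n x)$ and $G_2(x)=\sum_{n=1}^\infty \frac{\sigma_1(n)}{n^3}\cos(2\pi n x)$ for $x\in\mathbb{R}$. Then neither $F_2$ nor $G_2$ is differentiable at any $x\in\mathbb{Q}$. However, $G_2$ is right differentiable and left differentiable at each $x\in\mathbb{Q}$.
   Context: $\sigma_1(n)=\sum_{d\mid n} d$ is the sum-of-divisors function. Both series converge (absolutely and uniformly) on $\mathbb{R}$ to continuous functions. *)

theory Defs
  imports "HOL-Analysis.Analysis"
begin

definition sigma1 :: "nat \<Rightarrow> nat" where
  "sigma1 n = (\<Sum>d | d dvd n. d)"

text \<open>The series run over \<open>n \<ge> 1\<close>, hence the index shift by \<open>Suc\<close>.\<close>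

definition F2 :: "real \<Rightarrow> real" where
  "F2 x = (\<Sum>n. real (sigma1 (Suc n)) / real (Suc n) ^ 3 * sin (2 * pi * real (Suc n) * x))"

definition G2 :: "real \<Rightarrow> real" where
  "G2 x = (\<Sum>n. real (sigma1 (Suc n)) / real (Suc n) ^ 3 * cos (2 * pi * real (Suc n) * x))"

end

theory Submission
  imports Defs
begin

text \<open>
  Write \<open>C2 y = (\<Sum>n\<ge>1. cos (2\<pi>ny) / n\<^sup>2)\<close> and \<open>S3 y = (\<Sum>n\<ge>1. sin (2\<pi>ny) / n\<^sup>3)\<close>. Splitting
  \<open>n = dm\<close> in the divisor sum gives \<open>G2 x = (\<Sum>m. C2 (mx) / m\<^sup>3)\<close> and \<open>F2 x = (\<Sum>d. S3 (dx) / d\<^sup>2)\<close>.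
  The function \<open>C2\<close> is Lipschitz and equals \<open>C2 0 + \<pi>\<^sup>2(y\<^sup>2 - y)\<close> on \<open>[0,1]\<close>, with a corner at every integer.
  Hence \<open>G2\<close> can be differentiated termwise from either side, and the left derivative exceeds the
  right one by \<open>2\<pi>\<^sup>2\<close> times the sum of \<open>1/m\<^sup>2\<close> over those \<open>m\<close> with \<open>mx\<close> an integer.
  Since \<open>S3' = 2\<pi> C2\<close>, the difference quotient of \<open>F2\<close> at \<open>x\<close> with step \<open>1/N\<close> is bounded below by
  \<open>2\<pi> (\<Sum>d\<le>N. C2 (dx) / d) - O(1)\<close>. For \<open>x = p/q\<close> the numbers \<open>C2 (dx)\<close> have period \<open>q\<close> in \<open>d\<close> and positive mean,
  so this diverges logarithmically.
\<close>

section \<open>The component series and the regrouping of the divisor sum\<close>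

definition C2 :: "real \<Rightarrow> real" where
  "C2 y = (\<Sum>n. cos (2 * pi * real (Suc n) * y) / real (Suc n) ^ 2)"

definition S3 :: "real \<Rightarrow> real" where
  "S3 y = (\<Sum>n. sin (2 * pi * real (Suc n) * y) / real (Suc n) ^ 3)"

lemma summable_inverse_Suc_power:
  assumes "k \<ge> 2"
  shows "summable (\<lambda>n. 1 / real (Suc n) ^ k)"
  using summable_ignore_initial_segment[OF inverse_power_summable[OF assms, where 'a = real], of 1]
  by (simp add: inverse_eq_divide)

lemma summable_bounded_over_Suc_power:
  fixes c :: "nat \<Rightarrow> real"
  assumes "k \<ge> 2" and "\<And>n. \<bar>c n\<bar> \<le> B"
  shows "summable (\<lambda>n. c n / real (Suc n) ^ k)"
  by (rule summable_comparison_test'[where N = 0, OF summable_mult[OF summable_inverse_Suc_power[OF assms(1)], of B]])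
    (use assms in \<open>auto intro!: divide_right_mono\<close>)

text \<open>Carries values known as ordered series over to unordered sums, where the order of
  summation can be exchanged.\<close>

lemma summable_on_sums_imp_has_sum:
  fixes f :: "nat \<Rightarrow> real"
  assumes "f summable_on UNIV" "f sums s"
  shows "(f has_sum s) UNIV"
  using has_sum_infsum[OF assms(1)]
    sums_unique2[OF has_sum_imp_sums[OF has_sum_infsum[OF assms(1)]] assms(2)] by simp

text \<open>Both iterated sums evaluate the double series of \<open>e(dm) / (d^2 m^3)\<close>, which
  is absolutely summable because it is dominated by a product of two convergent series. Grouping by
  \<open>n = dm\<close> turns \<open>1 / (d^2 m^3)\<close> into \<open>d / n^3\<close>, and summing
  over the divisors \<open>d\<close> of \<open>n\<close> produces \<open>sigma1\<close>. An
  arbitrary bounded \<open>e\<close> covers sine and cosine at once.\<close>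

lemma sigma1_series_sums:
  fixes e :: "nat \<Rightarrow> real"
  assumes e: "\<And>n. \<bar>e n\<bar> \<le> 1"
  defines "S \<equiv> (\<Sum>n. real (sigma1 (Suc n)) / real (Suc n) ^ 3 * e (Suc n))"
  shows "(\<lambda>m. (\<Sum>d. e (Suc d * Suc m) / real (Suc d) ^ 2) / real (Suc m) ^ 3) sums S"
    and "(\<lambda>d. (\<Sum>m. e (Suc d * Suc m) / real (Suc m) ^ 3) / real (Suc d) ^ 2) sums S"
proof -
  define f where "f = (\<lambda>(d, m). e (Suc d * Suc m) / (real (Suc d) ^ 2 * real (Suc m) ^ 3))"
  have nsum: "(\<lambda>n. 1 / real (Suc n) ^ k) summable_on UNIV" if "k \<ge> 2" for k
    using summable_inverse_Suc_power[OF that]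
    by (subst summable_on_UNIV_nonneg_real_iff) auto
  have "(\<lambda>(d, m). (1 / real (Suc d) ^ 2) * (1 / real (Suc m) ^ 3)) summable_on UNIV \<times> UNIV"
    by (rule summable_on_SigmaI[where g = "\<lambda>d. 1 / real (Suc d) ^ 2 * (\<Sum>\<^sub>\<infinity>m. 1 / real (Suc m) ^ 3)"],
        unfold prod.case)
      (intro has_sum_cmult_right has_sum_infsum nsum, simp,
        rule summable_on_cmult_left[OF nsum], simp_all)
  then have f_summable: "f summable_on UNIV \<times> UNIV"
    by (rule abs_summable_summable[OF Infinite_Sum.abs_summable_on_comparison_test'])
      (auto simp: f_def abs_mult divide_simps e)
  then obtain T where T: "(f has_sum T) (UNIV \<times> UNIV)"
    by (auto simp: summable_on_def)
  have row: "(\<lambda>m. f (d, m)) sums ((\<Sum>m. e (Suc d * Suc m) / real (Suc m) ^ 3) / real (Suc d) ^ 2)"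
    and col: "(\<lambda>d. f (d, m)) sums ((\<Sum>d. e (Suc d * Suc m) / real (Suc d) ^ 2) / real (Suc m) ^ 3)" for d m
    using sums_divide[OF summable_sums[OF summable_bounded_over_Suc_power[where k = 3 and B = 1 and c = "\<lambda>m. e (Suc d * Suc m)"]],
        of "real (Suc d) ^ 2"]
      sums_divide[OF summable_sums[OF summable_bounded_over_Suc_power[where k = 2 and B = 1 and c = "\<lambda>d. e (Suc d * Suc m)"]],
        of "real (Suc m) ^ 3"] e
    by (simp_all add: f_def mult.commute del: mult_Suc mult_Suc_right of_nat_Suc)
  have f1: "(\<lambda>m. f (d, m)) summable_on UNIV" for d
    by (rule summable_on_SigmaD1[where f = "\<lambda>x y. f (x, y)" and A = UNIV and B = "\<lambda>_. UNIV"])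
      (use f_summable in auto)
  have f2: "(\<lambda>d. f (d, m)) summable_on UNIV" for m
    by (rule summable_on_SigmaD1[where f = "\<lambda>x y. f (y, x)" and A = UNIV and B = "\<lambda>_. UNIV"])
      (use f_summable summable_on_swap[of f UNIV UNIV] in \<open>auto simp: case_prod_unfold\<close>)
  have row': "((\<lambda>m. f (d, m)) has_sum ((\<Sum>m. e (Suc d * Suc m) / real (Suc m) ^ 3) / real (Suc d) ^ 2)) UNIV" for d
    by (rule summable_on_sums_imp_has_sum[OF f1 row])
  have col': "((\<lambda>d. f (d, m)) has_sum ((\<Sum>d. e (Suc d * Suc m) / real (Suc d) ^ 2) / real (Suc m) ^ 3)) UNIV" for m
    by (rule summable_on_sums_imp_has_sum[OF f2 col])
  \<comment> \<open>Bijection between factorisations and divisors: the pair of factors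
    \<open>Suc a\<close>, \<open>Suc b\<close> goes to the number \<open>Suc a * Suc b\<close>,
    stored as its predecessor, with the divisor \<open>Suc a\<close>, stored unshifted.\<close>
  have "((\<lambda>(n, d). real d / real (Suc n) ^ 3 * e (Suc n)) has_sum T) (SIGMA n:UNIV. {d. d dvd Suc n})
      \<longleftrightarrow> (f has_sum T) (UNIV \<times> UNIV)"
  proof (rule has_sum_reindex_bij_witness[where i = "\<lambda>(a, b). (Suc a * Suc b - 1, Suc a)"
        and j = "\<lambda>(n, d). (d - 1, Suc n div d - 1)"])
    fix p assume p: "p \<in> (SIGMA n:UNIV. {d::nat. d dvd Suc n})"
    obtain n d where [simp]: "p = (n, d)" by force
    from p obtain k where k: "Suc n = d * k" by auto
    then have pos: "d > 0" "k > 0" by (auto intro: Nat.gr0I)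
    with k have "Suc n div d = k" by simp
    then show "(\<lambda>(a, b). (Suc a * Suc b - 1, Suc a)) ((\<lambda>(n, d). (d - 1, Suc n div d - 1)) p) = p"
      using k[symmetric] pos by (simp del: mult_Suc mult_Suc_right)
    have "real (Suc n) = real d * real k" using k by (metis of_nat_mult)
    then show "f ((\<lambda>(n, d). (d - 1, Suc n div d - 1)) p) = (\<lambda>(n, d). real d / real (Suc n) ^ 3 * e (Suc n)) p"
      using \<open>Suc n div d = k\<close> k pos
      by (simp add: f_def field_simps power2_eq_square power3_eq_cube del: of_nat_Suc mult_Suc mult_Suc_right)
  qed (auto simp del: mult_Suc mult_Suc_right)
  with T have "((\<lambda>(n, d). real d / real (Suc n) ^ 3 * e (Suc n)) has_sum T) (SIGMA n:UNIV. {d. d dvd Suc n})"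
    by simp
  then have "((\<lambda>n. real (sigma1 (Suc n)) / real (Suc n) ^ 3 * e (Suc n)) has_sum T) UNIV"
    by (rule has_sum_Sigma')
      (auto intro!: has_sum_finiteI simp: sigma1_def sum_divide_distrib sum_distrib_right simp del: of_nat_Suc)
  then have "T = S"
    using has_sum_imp_sums sums_unique unfolding S_def by blast
  with T have T': "(f has_sum S) (UNIV \<times> UNIV)" by simp
  show "(\<lambda>d. (\<Sum>m. e (Suc d * Suc m) / real (Suc m) ^ 3) / real (Suc d) ^ 2) sums S"
    by (rule has_sum_imp_sums[OF has_sum_Sigma'[OF T' row']])
  have T_swap: "((\<lambda>(m, d). f (d, m)) has_sum S) (UNIV \<times> UNIV)"
    using T' has_sum_swap by blast
  show "(\<lambda>m. (\<Sum>d. e (Suc d * Suc m) / real (Suc d) ^ 2) / real (Suc m) ^ 3) sums S"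
    by (rule has_sum_imp_sums[OF has_sum_Sigma'[OF T_swap]]) (simp only: prod.case col')
qed

lemma G2_sums: "(\<lambda>m. C2 (real (Suc m) * x) / real (Suc m) ^ 3) sums G2 x"
  using sigma1_series_sums(1)[of "\<lambda>n. cos (2 * pi * real n * x)"]
  by (simp add: C2_def G2_def mult.assoc del: of_nat_Suc mult_Suc mult_Suc_right)

lemma F2_sums: "(\<lambda>d. S3 (real (Suc d) * x) / real (Suc d) ^ 2) sums F2 x"
  using sigma1_series_sums(2)[of "\<lambda>n. sin (2 * pi * real n * x)"]
  by (simp add: S3_def F2_def mult_ac del: of_nat_Suc mult_Suc mult_Suc_right)

section \<open>Periodicity of \<open>C2\<close>; boundedness and derivative of
  \<open>S3\<close>\<close>

lemma summable_C2:
  "summable (\<lambda>n. cos (2 * pi * real (Suc n) * y) / real (Suc n) ^ 2)"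
  by (rule summable_bounded_over_Suc_power[where B = 1]) auto

lemma C2_add_int: "C2 (y + of_int k) = C2 y"
proof -
  have "cos (2 * pi * real (Suc n) * (y + of_int k)) = cos (2 * pi * real (Suc n) * y)" for n
  proof -
    have "2 * pi * real (Suc n) * (y + of_int k) = 2 * pi * real (Suc n) * y + of_int (int (Suc n) * k) * (2 * pi)"
      by (simp add: algebra_simps)
    then show ?thesis
      using sin_cos_eq_iff by (metis (no_types, lifting) mult.commute)
  qed
  then show ?thesis by (simp add: C2_def)
qed

lemma S3_bounded: "\<exists>M. \<forall>y. \<bar>S3 y\<bar> \<le> M"
proof (intro exI allI)
  fix y
  have "norm (S3 y) \<le> (\<Sum>n. 1 / real (Suc n) ^ 3)"
    unfolding S3_def using summable_inverse_Suc_power[of 3]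
    by (intro norm_suminf_le) (auto simp: divide_right_mono)
  then show "\<bar>S3 y\<bar> \<le> (\<Sum>n. 1 / real (Suc n) ^ 3)" by simp
qed

text \<open>The differentiated series is dominated by a multiple of the sum of
  \<open>1 / n^2\<close>, so it converges uniformly and termwise differentiation is
  legitimate.\<close>

lemma S3_deriv: "(S3 has_real_derivative 2 * pi * C2 y) (at y)"
proof -
  have "((\<lambda>x. \<Sum>n. sin (2 * pi * real (Suc n) * x) / real (Suc n) ^ 3) has_field_derivative
     (\<Sum>n. 2 * pi * (cos (2 * pi * real (Suc n) * y) / real (Suc n) ^ 2))) (at y)"
  proof (rule has_field_derivative_series'(2)[where S = UNIV and
        f = "\<lambda>n x. sin (2 * pi * real (Suc n) * x) / real (Suc n) ^ 3" and
        f' = "\<lambda>n x. 2 * pi * (cos (2 * pi * real (Suc n) * x) / real (Suc n) ^ 2)"])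
    show "uniformly_convergent_on UNIV (\<lambda>n x. \<Sum>i<n. 2 * pi * (cos (2 * pi * real (Suc i) * x) / real (Suc i) ^ 2))"
    proof (rule Weierstrass_m_test'[where M = "\<lambda>i. 2 * pi * (1 / real (Suc i) ^ 2)"])
      show "summable (\<lambda>i. 2 * pi * (1 / real (Suc i) ^ 2))"
        by (intro summable_mult summable_inverse_Suc_power) simp
    qed (auto simp: abs_mult divide_right_mono)
    have "((\<lambda>x. sin (2 * pi * c * x) / c ^ 3) has_real_derivative 2 * pi * (cos (2 * pi * c * t) / c ^ 2)) (at t)"
      if "c > 0" for c t
      using that by (auto intro!: derivative_eq_intros simp: power2_eq_square power3_eq_cube)
    then show "((\<lambda>x. sin (2 * pi * real (Suc n) * x) / real (Suc n) ^ 3) has_real_derivative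
        2 * pi * (cos (2 * pi * real (Suc n) * t) / real (Suc n) ^ 2)) (at t within UNIV)" for n t
      by (simp del: of_nat_Suc)
    show "summable (\<lambda>n. sin (2 * pi * real (Suc n) * 0) / real (Suc n) ^ 3)"
      by simp
  qed simp_all
  then show ?thesis
    unfolding suminf_mult[OF summable_C2] by (simp add: S3_def[abs_def] C2_def del: of_nat_Suc)
qed

section \<open>Abel means of \<open>C2\<close> and the Lipschitz bound\<close>

lemma summable_abs_C2: "summable (\<lambda>n. \<bar>cos (2 * pi * real (Suc n) * y) / real (Suc n) ^ 2\<bar>)"
  using summable_bounded_over_Suc_power[of 2 "\<lambda>n. \<bar>cos (2 * pi * real (Suc n) * y)\<bar>" 1] by simp

text \<open>The termwise derivative of \<open>C2\<close> is only conditionally convergent, whereas that of its Abel means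
  is the imaginary part of a logarithm, bounded uniformly in \<open>r\<close>.\<close>

definition C2_abel :: "real \<Rightarrow> real \<Rightarrow> real" where
  "C2_abel r y = (\<Sum>n. r ^ Suc n * (cos (2 * pi * real (Suc n) * y) / real (Suc n) ^ 2))"

text \<open>For \<open>r < 1\<close> the differentiated series has a geometric majorant. Its sum
  comes from \<open>Ln (1 - z) = - (z + z^2/2 + ...)\<close> at
  \<open>z = r * cis (2 * pi * y)\<close>, by taking imaginary parts.\<close>

lemma C2_abel_deriv:
  assumes r: "0 \<le> r" "r < 1"
  shows "(C2_abel r has_real_derivative 2 * pi * Im (Ln (1 - complex_of_real r * cis (2 * pi * y)))) (at y)"
proof -
  let ?f' = "\<lambda>n x. - (2 * pi * (r ^ Suc n * sin (2 * pi * real (Suc n) * x) / real (Suc n)))"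
  have summable_r: "summable (\<lambda>n. r ^ Suc n * 1)"
    using r by (simp add: summable_mult summable_geometric)
  have "((\<lambda>x. \<Sum>n. r ^ Suc n * (cos (2 * pi * real (Suc n) * x) / real (Suc n) ^ 2)) has_field_derivative
     (\<Sum>n. ?f' n y)) (at y)"
  proof (rule has_field_derivative_series'(2)[where S = UNIV and f' = ?f' and
        f = "\<lambda>n x. r ^ Suc n * (cos (2 * pi * real (Suc n) * x) / real (Suc n) ^ 2)"])
    show "uniformly_convergent_on UNIV (\<lambda>n x. \<Sum>i<n. ?f' i x)"
    proof (rule Weierstrass_m_test'[where M = "\<lambda>i. 2 * pi * (r ^ Suc i * 1)"])
      show "norm (?f' n x) \<le> 2 * pi * (r ^ Suc n * 1)" for n x
      proof -
        have "\<bar>sin (2 * pi * real (Suc n) * x) / real (Suc n)\<bar> \<le> 1"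
          using order.trans[OF abs_sin_le_one[of "2 * pi * real (Suc n) * x"], of "real (Suc n)"]
          by (simp add: divide_simps del: of_nat_Suc)
        then have "r ^ Suc n * \<bar>sin (2 * pi * real (Suc n) * x) / real (Suc n)\<bar> \<le> r ^ Suc n * 1"
          using r by (intro mult_left_mono) auto
        from mult_left_mono[OF this, of "2 * pi"] show ?thesis
          using r by (simp add: abs_mult mult.assoc del: of_nat_Suc power_Suc)
      qed
    qed (intro summable_mult summable_r)
    show "summable (\<lambda>n. r ^ Suc n * (cos (2 * pi * real (Suc n) * 0) / real (Suc n) ^ 2))"
    proof (rule summable_comparison_test'[OF summable_r, where N = 0])
      fix n
      have "1 / real (Suc n) ^ 2 \<le> 1" by simp
      from mult_left_mono[OF this, of "r ^ Suc n"]
      show "norm (r ^ Suc n * (cos (2 * pi * real (Suc n) * 0) / real (Suc n) ^ 2)) \<le> r ^ Suc n * 1"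
        using r by (simp add: abs_mult del: of_nat_Suc power_Suc)
    qed
    have "((\<lambda>x. k * (cos (2 * pi * c * x) / c ^ 2)) has_real_derivative - (2 * pi * (k * sin (2 * pi * c * t) / c))) (at t)"
      if "c > 0" for c t k
      using that by (auto intro!: derivative_eq_intros simp: power2_eq_square)
    then show "((\<lambda>x. r ^ Suc n * (cos (2 * pi * real (Suc n) * x) / real (Suc n) ^ 2)) has_real_derivative ?f' n t) (at t within UNIV)" for n t
      by (simp del: of_nat_Suc power_Suc)
  qed simp_all
  moreover have "(\<Sum>n. ?f' n y) = 2 * pi * Im (Ln (1 - complex_of_real r * cis (2 * pi * y)))"
  proof -
    let ?z = "complex_of_real r * cis (2 * pi * y)"
    have "cmod (- ?z) < 1" using r by (simp add: norm_mult)
    from Ln_series'[OF this] have "(\<lambda>n. - (?z ^ n) / of_nat n) sums Ln (1 - ?z)" by simp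
    \<comment> \<open>Dropping index 0 leaves the sum unchanged: that term divides by zero and is
      therefore 0.\<close>
    then have "(\<lambda>n. - (?z ^ Suc n) / of_nat (Suc n)) sums Ln (1 - ?z)"
      by (subst sums_Suc_iff) simp
    from sums_mult[OF sums_Im[OF this], of "2 * pi"]
    have "(\<lambda>n. ?f' n y) sums (2 * pi * Im (Ln (1 - ?z)))"
      by (simp add: power_mult_distrib Complex.DeMoivre Im_divide_of_nat mult_ac del: of_nat_Suc power_Suc
          flip: of_real_power)
    then show ?thesis by (simp add: sums_iff)
  qed
  ultimately show ?thesis by (simp add: C2_abel_def[abs_def])
qed

text \<open>Abel's limit along the radii \<open>k / (k + 1)\<close>, which stay below 1 and tend to
  1. Tannery's theorem applies since the terms of \<open>C2\<close> themselves majorise the damped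
  ones for every radius.\<close>

lemma C2_abel_tendsto:
  "(\<lambda>k. C2_abel (real k / real (Suc k)) y) \<longlonglongrightarrow> C2 y"
  unfolding C2_abel_def C2_def
proof (rule tannerys_theorem[THEN conjunct2, THEN conjunct2])
  fix n
  have "(\<lambda>k. (real k / real (Suc k)) ^ Suc n * (cos (2 * pi * real (Suc n) * y) / real (Suc n) ^ 2))
      \<longlonglongrightarrow> 1 ^ Suc n * (cos (2 * pi * real (Suc n) * y) / real (Suc n) ^ 2)"
    by (intro tendsto_intros LIMSEQ_n_over_Suc_n)
  then show "(\<lambda>k. (real k / real (Suc k)) ^ Suc n * (cos (2 * pi * real (Suc n) * y) / real (Suc n) ^ 2))
      \<longlonglongrightarrow> cos (2 * pi * real (Suc n) * y) / real (Suc n) ^ 2" by simp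
next
  show "summable (\<lambda>n. \<bar>cos (2 * pi * real (Suc n) * y) / real (Suc n) ^ 2\<bar>)"
    by (rule summable_abs_C2)
  have *: "\<bar>(real k / real (Suc k)) ^ Suc n * c\<bar> \<le> \<bar>c\<bar>" for k n and c :: real
    unfolding abs_mult by (rule mult_left_le_one_le) (auto intro!: power_le_one simp del: power_Suc)
  show "\<forall>\<^sub>F (n, k) in sequentially \<times>\<^sub>F sequentially.
      norm ((real k / real (Suc k)) ^ Suc n * (cos (2 * pi * real (Suc n) * y) / real (Suc n) ^ 2))
      \<le> \<bar>cos (2 * pi * real (Suc n) * y) / real (Suc n) ^ 2\<bar>"
    by (intro always_eventually) (simp only: case_prod_beta real_norm_def * simp_thms)
qed simp

lemma abs_Im_Ln_le_pi: "z \<noteq> 0 \<Longrightarrow> \<bar>Im (Ln z)\<bar> \<le> pi"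
  using Im_Ln_le_pi[of z] mpi_less_Im_Ln[of z] by linarith

lemma one_minus_cis_nonzero:
  assumes "0 \<le> r" "r < 1"
  shows "1 - complex_of_real r * cis t \<noteq> 0"
proof
  assume "1 - complex_of_real r * cis t = 0"
  then have "cmod (complex_of_real r * cis t) = 1" by simp
  with assms show False by (simp add: norm_mult)
qed

text \<open>The derivative of each Abel mean is at most \<open>2 * pi * pi\<close> in absolute
  value, because the principal argument is at most \<open>pi\<close>. This bound does not depend on
  the radius and so survives the limit.\<close>

lemma C2_lipschitz: "\<bar>C2 y - C2 z\<bar> \<le> 2 * pi\<^sup>2 * \<bar>y - z\<bar>"
proof (rule LIMSEQ_le_const2)
  show "(\<lambda>k. \<bar>C2_abel (real k / real (Suc k)) y - C2_abel (real k / real (Suc k)) z\<bar>) \<longlonglongrightarrow> \<bar>C2 y - C2 z\<bar>"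
    by (intro tendsto_intros C2_abel_tendsto)
  have "norm (C2_abel r y - C2_abel r z) \<le> 2 * pi\<^sup>2 * norm (y - z)" if r: "0 \<le> r" "r < 1" for r
  proof (rule field_differentiable_bound[where S = UNIV])
    show "norm (2 * pi * Im (Ln (1 - complex_of_real r * cis (2 * pi * t)))) \<le> 2 * pi\<^sup>2" for t
      using abs_Im_Ln_le_pi[OF one_minus_cis_nonzero[OF r]] by (simp add: abs_mult power2_eq_square)
  qed (use C2_abel_deriv[OF r] in auto)
  then show "\<exists>N. \<forall>k\<ge>N. \<bar>C2_abel (real k / real (Suc k)) y - C2_abel (real k / real (Suc k)) z\<bar> \<le> 2 * pi\<^sup>2 * \<bar>y - z\<bar>"
    by (auto simp: field_simps)
qed

section \<open>The quadratic formula for \<open>C2\<close>\<close>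

text \<open>With \<open>s = pi * y\<close> one has
  \<open>1 - cis (2 * s) = 2 * sin s * cis (s - pi / 2)\<close>. For \<open>0 < s < pi\<close> the
  factor \<open>2 * sin s\<close> is positive and the angle is in the principal range, so it is the
  argument.\<close>

lemma Im_Ln_one_minus_cis:
  assumes "0 < y" "y < 1"
  shows "Im (Ln (1 - cis (2 * pi * y))) = pi * y - pi / 2"
proof -
  have "1 - cis (2 * pi * y) = rcis (2 * sin (pi * y)) (pi * y - pi / 2)"
  proof -
    have "cos (2 * pi * y) = 1 - 2 * sin (pi * y) ^ 2" "sin (2 * pi * y) = 2 * sin (pi * y) * cos (pi * y)"
      using cos_double_sin[of "pi * y"] sin_double[of "pi * y"] by (simp_all add: mult.assoc)
    then show ?thesis
      by (simp add: complex_eq_iff cos_diff sin_diff power2_eq_square)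
  qed
  moreover have "sin (pi * y) > 0" using assms by (intro sin_gt_zero) auto
  moreover have "pi * y < pi * 1" using assms by (intro mult_strict_left_mono) auto
  moreover have "0 < pi * y" using assms by auto
  moreover have "- pi < pi * y - pi / 2 \<and> pi * y - pi / 2 \<le> pi"
    using \<open>0 < pi * y\<close> \<open>pi * y < pi * 1\<close> pi_gt_zero by linarith
  ultimately have "Arg (1 - cis (2 * pi * y)) = pi * y - pi / 2"
    by (intro Arg_unique'[of "2 * sin (pi * y)"]) auto
  moreover have "1 - cis (2 * pi * y) \<noteq> 0"
    using \<open>1 - cis (2 * pi * y) = _\<close> \<open>sin (pi * y) > 0\<close> by simp
  ultimately show ?thesis by (simp add: Arg_def)
qed

text \<open>The derivative of the Abel means is integrated over \<open>[a, b]\<close> and the radius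
  sent to 1 by dominated convergence, with constant majorant \<open>2 * pi * pi\<close>. The
  limiting integrand is linear, with primitive \<open>pi^2 * (t^2 - t)\<close>.\<close>

lemma C2_diff_integral:
  assumes "0 < a" "a \<le> b" "b < 1"
  shows "C2 b - C2 a = pi\<^sup>2 * (b\<^sup>2 - b) - pi\<^sup>2 * (a\<^sup>2 - a)"
proof -
  let ?r = "\<lambda>k. real k / real (Suc k)"
  let ?g = "\<lambda>k t. 2 * pi * Im (Ln (1 - complex_of_real (?r k) * cis (2 * pi * t)))"
  have r: "0 \<le> ?r k" "?r k < 1" for k by (auto simp: field_simps)
  have FTC: "(?g k has_integral C2_abel (?r k) b - C2_abel (?r k) a) {a..b}" for k
    using C2_abel_deriv[OF r] \<open>a \<le> b\<close>
    by (intro fundamental_theorem_of_calculus)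
      (auto simp: has_real_derivative_iff_has_vector_derivative[symmetric] intro: has_field_derivative_at_within)
  have lim_integral: "(\<lambda>k. integral {a..b} (?g k)) \<longlonglongrightarrow> integral {a..b} (\<lambda>t. 2 * pi * (pi * t - pi / 2))"
  proof (rule dominated_convergence(2)[where h = "\<lambda>_. 2 * pi * pi"])
    show "?g k integrable_on {a..b}" for k using FTC by (rule has_integral_integrable)
    show "norm (?g k t) \<le> 2 * pi * pi" for k t
      using abs_Im_Ln_le_pi[OF one_minus_cis_nonzero[OF r]] by (simp add: abs_mult del: of_nat_Suc)
    show "(\<lambda>k. ?g k t) \<longlonglongrightarrow> 2 * pi * (pi * t - pi / 2)" if "t \<in> {a..b}" for t
    proof -
      have t: "0 < t" "t < 1" using that assms by auto
      \<comment> \<open>The real part is \<open>2 * sin (pi * t)^2 > 0\<close>, which keeps the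
        limit point off the branch cut, where \<open>Ln\<close> is continuous.\<close>
      have nz: "1 - complex_of_real 1 * cis (2 * pi * t) \<notin> \<real>\<^sub>\<le>\<^sub>0"
      proof -
        have "0 < sin (pi * t)" using t by (intro sin_gt_zero) auto
        then have "Re (1 - cis (2 * pi * t)) > 0"
          using cos_double_sin[of "pi * t"] by (simp add: mult.assoc)
        then show ?thesis by (auto simp: complex_nonpos_Reals_iff)
      qed
      have "(\<lambda>k. ?g k t) \<longlonglongrightarrow> 2 * pi * Im (Ln (1 - complex_of_real 1 * cis (2 * pi * t)))"
        by (intro tendsto_intros LIMSEQ_n_over_Suc_n nz)
      then show ?thesis using Im_Ln_one_minus_cis[OF t] by simp
    qed
  qed auto
  have lim_C2: "(\<lambda>k. integral {a..b} (?g k)) \<longlonglongrightarrow> C2 b - C2 a"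
    using integral_unique[OF FTC] tendsto_diff[OF C2_abel_tendsto C2_abel_tendsto, of b a] by simp
  have "((\<lambda>t. 2 * pi * (pi * t - pi / 2)) has_integral pi\<^sup>2 * (b\<^sup>2 - b) - pi\<^sup>2 * (a\<^sup>2 - a)) {a..b}"
    using \<open>a \<le> b\<close>
    by (intro fundamental_theorem_of_calculus)
      (auto simp: has_real_derivative_iff_has_vector_derivative[symmetric] power2_eq_square algebra_simps
        intro!: derivative_eq_intros)
  from integral_unique[OF this] show ?thesis
    using LIMSEQ_unique[OF lim_C2 lim_integral] by (rule trans[rotated])
qed

lemma C2_continuous_on: "continuous_on S C2"
proof -
  have "(2 * pi\<^sup>2)-lipschitz_on S C2"
    by (intro lipschitz_onI) (use C2_lipschitz in \<open>auto simp: dist_real_def\<close>)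
  then show ?thesis by (rule lipschitz_on_continuous_on)
qed

text \<open>The difference of \<open>C2\<close> and the quadratic is constant on the open interval;
  continuity extends this to the endpoints, and the value at 0 identifies the constant.\<close>

lemma C2_unit_interval:
  assumes "y \<in> {0..1}"
  shows "C2 y = C2 0 + pi\<^sup>2 * (y\<^sup>2 - y)"
proof -
  let ?K = "\<lambda>y. C2 y - pi\<^sup>2 * (y\<^sup>2 - y)"
  have interior: "?K y = ?K (1/2)" if "y \<in> {0<..<1}" for y
    using C2_diff_integral[of y "1/2"] C2_diff_integral[of "1/2" y] that
    by (cases "y \<le> 1/2") auto
  have "?K y = ?K (1/2)" if "y \<in> {0..1}" for y
  proof (rule continuous_constant_on_closure[where S = "{0<..<1::real}" and f = ?K])
    show "continuous_on (closure {0<..<1::real}) ?K"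
      by (intro continuous_intros C2_continuous_on)
    show "y \<in> closure {0<..<1::real}" using that by simp
  qed (rule interior)
  from this[of y] this[of 0] assms show ?thesis by simp
qed

lemma C2_int_interval:
  assumes "of_int k \<le> y" "y \<le> of_int k + 1"
  shows "C2 y = C2 0 + pi\<^sup>2 * ((y - of_int k)\<^sup>2 - (y - of_int k))"
  using C2_add_int[of "y - of_int k" k] C2_unit_interval[of "y - of_int k"] assms by simp

section \<open>One-sided derivatives of \<open>C2\<close>\<close>

lemma C2_right_deriv:
  "(C2 has_real_derivative pi\<^sup>2 * (2 * (y - of_int \<lfloor>y\<rfloor>) - 1)) (at_right y)"
proof (rule has_field_derivative_cong_eventually[THEN iffD2])
  let ?k = "\<lfloor>y\<rfloor>"
  show "\<forall>\<^sub>F t in at_right y. C2 t = C2 0 + pi\<^sup>2 * ((t - of_int ?k)\<^sup>2 - (t - of_int ?k))"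
    using eventually_at_right_real[of y "of_int ?k + 1"]
  proof (rule eventually_mono)
    fix t assume "t \<in> {y<..<of_int ?k + 1}"
    then show "C2 t = C2 0 + pi\<^sup>2 * ((t - of_int ?k)\<^sup>2 - (t - of_int ?k))"
      using of_int_floor_le[of y] by (intro C2_int_interval) (simp_all, linarith)
  qed linarith
  show "C2 y = C2 0 + pi\<^sup>2 * ((y - of_int ?k)\<^sup>2 - (y - of_int ?k))"
    by (intro C2_int_interval) linarith+
qed (auto intro!: derivative_eq_intros simp: algebra_simps)

lemma C2_left_deriv:
  "(C2 has_real_derivative pi\<^sup>2 * (2 * (y - of_int \<lceil>y\<rceil>) + 1)) (at_left y)"
proof (rule has_field_derivative_cong_eventually[THEN iffD2])
  \<comment> \<open>The unit interval containing points just left of \<open>y\<close>. At an integer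
    \<open>y\<close> it ends at \<open>y\<close>, whereas the interval given by the floor begins
    there; this is the source of the corner.\<close>
  let ?k = "\<lceil>y\<rceil> - 1"
  show "\<forall>\<^sub>F t in at_left y. C2 t = C2 0 + pi\<^sup>2 * ((t - of_int ?k)\<^sup>2 - (t - of_int ?k))"
    using eventually_at_left_real[of "of_int ?k" y]
  proof (rule eventually_mono)
    fix t assume "t \<in> {of_int ?k<..<y}"
    then show "C2 t = C2 0 + pi\<^sup>2 * ((t - of_int ?k)\<^sup>2 - (t - of_int ?k))"
      using le_of_int_ceiling[of y] by (intro C2_int_interval) (simp_all, linarith)
  qed linarith
  show "C2 y = C2 0 + pi\<^sup>2 * ((y - of_int ?k)\<^sup>2 - (y - of_int ?k))"
    by (intro C2_int_interval) linarith+
qed (auto intro!: derivative_eq_intros simp: algebra_simps)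

section \<open>Termwise one-sided differentiation of \<open>G2\<close>\<close>

text \<open>Difference quotients of the terms are bounded by the summable Lipschitz constants, so
  Tannery's theorem interchanges limit and sum. The set \<open>S\<close> lets one statement serve
  both sides.\<close>

lemma suminf_has_real_derivative_lipschitz:
  fixes f :: "nat \<Rightarrow> real \<Rightarrow> real"
  assumes deriv: "\<And>m. (f m has_real_derivative D m) (at x within S)"
    and nontriv: "at x within S \<noteq> bot"
    and lipschitz: "\<And>m y z. \<bar>f m y - f m z\<bar> \<le> L m * \<bar>y - z\<bar>" and "summable L"
    and sums: "\<And>y. (\<lambda>m. f m y) sums g y"
  shows "summable D" "(g has_real_derivative suminf D) (at x within S)"
proof -
  let ?q = "\<lambda>m y. (f m y - f m x) / (y - x)"
  have "L m \<ge> 0" for m using lipschitz[of m 1 0] by simp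
  \<comment> \<open>At \<open>y = x\<close> the quotient is 0 by division by zero, so the bound
    holds for every \<open>y\<close>.\<close>
  then have bound: "norm (?q m y) \<le> L m" for m y
    using lipschitz[of m y x] by (cases "y = x") (auto simp: field_simps)
  have *: "(\<forall>\<^sub>F y in at x within S. summable (\<lambda>m. norm (?q m y))) \<and> summable (\<lambda>m. norm (D m)) \<and>
      ((\<lambda>y. \<Sum>m. ?q m y) \<longlongrightarrow> suminf D) (at x within S)"
    using deriv bound \<open>summable L\<close> nontriv
    by (intro tannerys_theorem[where M = L]) (auto simp: has_field_derivative_iff intro!: always_eventually)
  then show "summable D" by (blast intro: summable_norm_cancel)
  have "(\<Sum>m. ?q m y) = (g y - g x) / (y - x)" for y
    by (rule sums_unique[symmetric, OF sums_divide[OF sums_diff[OF sums sums]]])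
  with * show "(g has_real_derivative suminf D) (at x within S)"
    by (simp add: has_field_derivative_iff)
qed

definition G2_right_deriv_term :: "real \<Rightarrow> nat \<Rightarrow> real" where
  "G2_right_deriv_term x m =
     pi\<^sup>2 * (2 * (real (Suc m) * x - of_int \<lfloor>real (Suc m) * x\<rfloor>) - 1) / real (Suc m) ^ 2"

definition G2_left_deriv_term :: "real \<Rightarrow> nat \<Rightarrow> real" where
  "G2_left_deriv_term x m =
     pi\<^sup>2 * (2 * (real (Suc m) * x - of_int \<lceil>real (Suc m) * x\<rceil>) + 1) / real (Suc m) ^ 2"

lemma scaled_C2_deriv:
  assumes "(C2 has_real_derivative D) (at (c * x) within (*) c ` S)" "c > 0"
  shows "((\<lambda>x. C2 (c * x) / c ^ 3) has_real_derivative D / c ^ 2) (at x within S)"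
proof -
  have "((*) c has_real_derivative c) (at x within S)"
    by (auto intro!: derivative_eq_intros)
  from DERIV_cdivide[OF DERIV_image_chain[OF assms(1) this], of "c ^ 3"] show ?thesis
    using \<open>c > 0\<close> by (simp add: o_def power2_eq_square power3_eq_cube)
qed

text \<open>One factor \<open>c\<close> comes from rescaling the argument, leaving
  \<open>1 / c^2\<close>, which is summable over \<open>c = Suc m\<close>.\<close>

lemma scaled_C2_lipschitz:
  assumes "c > 0"
  shows "\<bar>C2 (c * y) / c ^ 3 - C2 (c * z) / c ^ 3\<bar> \<le> 2 * pi\<^sup>2 * (1 / c ^ 2) * \<bar>y - z\<bar>"
proof -
  have "\<bar>C2 (c * y) / c ^ 3 - C2 (c * z) / c ^ 3\<bar> = \<bar>C2 (c * y) - C2 (c * z)\<bar> / c ^ 3"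
    using assms by (simp add: diff_divide_distrib[symmetric])
  also have "\<dots> \<le> 2 * pi\<^sup>2 * \<bar>c * y - c * z\<bar> / c ^ 3"
    using assms by (intro divide_right_mono C2_lipschitz) auto
  also have "\<bar>c * y - c * z\<bar> = c * \<bar>y - z\<bar>"
    using assms by (simp add: abs_mult right_diff_distrib[symmetric])
  finally show ?thesis
    using assms by (simp add: power2_eq_square power3_eq_cube)
qed

lemma G2_right_deriv:
  "summable (G2_right_deriv_term x)"
  "(G2 has_real_derivative suminf (G2_right_deriv_term x)) (at_right x)"
proof -
  \<comment> \<open>Multiplication by the positive number \<open>Suc m\<close> maps points right of
    \<open>x\<close> to points right of \<open>Suc m * x\<close>, so the right derivative of
    \<open>C2\<close> suffices.\<close>
  have "((\<lambda>x. C2 (real (Suc m) * x) / real (Suc m) ^ 3) has_real_derivative G2_right_deriv_term x m) (at_right x)" for m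
    unfolding G2_right_deriv_term_def
    by (intro scaled_C2_deriv has_field_derivative_subset[OF C2_right_deriv]) auto
  note * = suminf_has_real_derivative_lipschitz[OF this _ scaled_C2_lipschitz summable_mult[OF summable_inverse_Suc_power] G2_sums]
  show "summable (G2_right_deriv_term x)"
  "(G2 has_real_derivative suminf (G2_right_deriv_term x)) (at_right x)"
    using * by (simp_all del: of_nat_Suc)
qed

lemma G2_left_deriv:
  "summable (G2_left_deriv_term x)"
  "(G2 has_real_derivative suminf (G2_left_deriv_term x)) (at_left x)"
proof -
  have "((\<lambda>x. C2 (real (Suc m) * x) / real (Suc m) ^ 3) has_real_derivative G2_left_deriv_term x m) (at_left x)" for m
    unfolding G2_left_deriv_term_def
    by (intro scaled_C2_deriv has_field_derivative_subset[OF C2_left_deriv]) auto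
  note * = suminf_has_real_derivative_lipschitz[OF this _ scaled_C2_lipschitz summable_mult[OF summable_inverse_Suc_power] G2_sums]
  show "summable (G2_left_deriv_term x)"
  "(G2 has_real_derivative suminf (G2_left_deriv_term x)) (at_left x)"
    using * by (simp_all del: of_nat_Suc)
qed

section \<open>Non-differentiability of \<open>G2\<close> at rationals\<close>

lemma Rats_denominator:
  fixes x :: real
  assumes "x \<in> \<rat>"
  obtains q p where "real (Suc q) * x = of_int p"
proof -
  from assms obtain a b :: int where "b > 0" "x = of_int a / of_int b" by (rule Rats_cases')
  moreover from \<open>b > 0\<close> have "real (Suc (nat b - 1)) = of_int b" by simp
  ultimately have "real (Suc (nat b - 1)) * x = of_int a" by simp
  then show thesis by (rule that)
qed

lemma G2_not_differentiable:
  assumes "x \<in> \<rat>"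
  shows "\<not> G2 differentiable at x"
proof
  assume "G2 differentiable at x"
  then obtain D where D: "(G2 has_real_derivative D) (at x)"
    by (auto simp: real_differentiable_def)
  have right: "suminf (G2_right_deriv_term x) = D"
    by (rule tendsto_unique[OF _ G2_right_deriv(2)[unfolded has_field_derivative_iff]
          has_field_derivative_at_within[OF D, unfolded has_field_derivative_iff]]) simp
  have left: "suminf (G2_left_deriv_term x) = D"
    by (rule tendsto_unique[OF _ G2_left_deriv(2)[unfolded has_field_derivative_iff]
          has_field_derivative_at_within[OF D, unfolded has_field_derivative_iff]]) simp
  have "suminf (\<lambda>m. G2_left_deriv_term x m - G2_right_deriv_term x m) = 0"
    unfolding suminf_diff[OF G2_left_deriv(1) G2_right_deriv(1), symmetric] left right by simp
  moreover have "suminf (\<lambda>m. G2_left_deriv_term x m - G2_right_deriv_term x m) > 0"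
  proof -
    \<comment> \<open>The integer \<open>\<lfloor>t\<rfloor> + 1 - \<lceil>t\<rceil>\<close> is 1 if
      \<open>t\<close> is an integer and 0 otherwise. Hence no jump is negative, and a denominator
      of \<open>x\<close> supplies a positive one.\<close>
    have jump: "G2_left_deriv_term x m - G2_right_deriv_term x m =
        2 * pi\<^sup>2 * of_int (\<lfloor>real (Suc m) * x\<rfloor> + 1 - \<lceil>real (Suc m) * x\<rceil>) / real (Suc m) ^ 2" for m
      unfolding G2_left_deriv_term_def G2_right_deriv_term_def diff_divide_distrib[symmetric]
      by (simp add: algebra_simps)
    obtain q p where q: "real (Suc q) * x = of_int p"
      using Rats_denominator[OF assms] .
    show ?thesis
    proof (rule suminf_pos2)
      show "summable (\<lambda>m. G2_left_deriv_term x m - G2_right_deriv_term x m)"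
        by (rule summable_diff[OF G2_left_deriv(1) G2_right_deriv(1)])
      have "0 \<le> (of_int (\<lfloor>t\<rfloor> + 1 - \<lceil>t\<rceil>) :: real)" for t :: real
        unfolding of_int_0_le_iff by linarith
      then show "0 \<le> G2_left_deriv_term x m - G2_right_deriv_term x m" for m
        unfolding jump by (intro divide_nonneg_nonneg mult_nonneg_nonneg) simp_all
      show "0 < G2_left_deriv_term x q - G2_right_deriv_term x q"
        unfolding jump q by (simp del: of_nat_Suc)
    qed
  qed
  ultimately show False by simp
qed

section \<open>Lower bound for the difference quotients of \<open>F2\<close>\<close>

text \<open>Mean value bound for \<open>S3 (a + s) - 2 * pi * C2 a * s\<close> on
  \<open>[0, t]\<close>: the Lipschitz bound for \<open>C2\<close> limits its derivative to
  \<open>2 * pi * (2 * pi^2 * t)\<close>.\<close>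

lemma S3_taylor:
  assumes "t \<ge> 0"
  shows "\<bar>S3 (a + t) - S3 a - 2 * pi * t * C2 a\<bar> \<le> 4 * pi ^ 3 * t\<^sup>2"
proof -
  let ?f = "\<lambda>s. S3 (a + s) - 2 * pi * C2 a * s"
  have "norm (?f t - ?f 0) \<le> (4 * pi ^ 3 * t) * norm (t - 0)"
  proof (rule field_differentiable_bound[where S = "{0..t}"])
    have "((\<lambda>s. S3 (a + s)) has_real_derivative 2 * pi * C2 (a + s)) (at s)" for s
      using DERIV_shift[of S3 _ s a] S3_deriv[of "a + s"] by (simp add: add.commute)
    from DERIV_diff[OF this DERIV_cmult_Id]
    show "(?f has_real_derivative 2 * pi * (C2 (a + s) - C2 a)) (at s within {0..t})" for s
      unfolding right_diff_distrib by (rule has_field_derivative_at_within)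
    show "norm (2 * pi * (C2 (a + s) - C2 a)) \<le> 4 * pi ^ 3 * t" if "s \<in> {0..t}" for s
    proof -
      have "\<bar>C2 (a + s) - C2 a\<bar> \<le> 2 * pi\<^sup>2 * s"
        using C2_lipschitz[of "a + s" a] that by simp
      also have "\<dots> \<le> 2 * pi\<^sup>2 * t"
        using that by simp
      finally have "2 * pi * \<bar>C2 (a + s) - C2 a\<bar> \<le> 2 * pi * (2 * pi\<^sup>2 * t)"
        by (rule mult_left_mono) simp
      then show ?thesis by (simp add: abs_mult power2_eq_square power3_eq_cube)
    qed
  qed (use assms in auto)
  then show ?thesis using assms by (simp add: power2_eq_square algebra_simps)
qed

text \<open>With \<open>h = 1 / N\<close>, each of the first \<open>N\<close> terms is expanded by
  \<open>S3_taylor\<close> at a cost of \<open>4 * pi^3 * h^2\<close>, in total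
  \<open>4 * pi^3 * h\<close>. The remaining terms cost at most \<open>2 * M * h\<close> by
  boundedness of \<open>S3\<close>. Division by \<open>h\<close> gives a constant free of
  \<open>N\<close> and \<open>x\<close>.\<close>

lemma F2_quotient_lower_bound:
  "\<exists>K. \<forall>x. \<forall>N>0.
    real N * (F2 (x + 1 / real N) - F2 x) \<ge> 2 * pi * (\<Sum>d<N. C2 (real (Suc d) * x) / real (Suc d)) - K"
proof -
  obtain M where M: "\<And>y. \<bar>S3 y\<bar> \<le> M" using S3_bounded by blast
  then have M0: "M \<ge> 0" using abs_ge_zero order.trans by blast
  have "real N * (F2 (x + 1 / real N) - F2 x) \<ge>
      2 * pi * (\<Sum>d<N. C2 (real (Suc d) * x) / real (Suc d)) - (4 * pi ^ 3 + 2 * M)" if "N > 0" for N x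
  proof -
    define h where "h = 1 / real N"
    have h: "h > 0" using that by (simp add: h_def)
    define u where "u = (\<lambda>d. (S3 (real (Suc d) * (x + h)) - S3 (real (Suc d) * x)) / real (Suc d) ^ 2)"
    have u_sums: "u sums (F2 (x + h) - F2 x)"
      using sums_diff[OF F2_sums[of "x + h"] F2_sums[of x]] by (simp add: u_def diff_divide_distrib)
    have head: "u d \<ge> 2 * pi * h * (C2 (real (Suc d) * x) / real (Suc d)) - 4 * pi ^ 3 * h\<^sup>2" for d
    proof -
      define D where "D = real (Suc d)"
      have "D > 0" by (simp add: D_def)
      have "S3 (D * (x + h)) - S3 (D * x) \<ge> 2 * pi * (D * h) * C2 (D * x) - 4 * pi ^ 3 * (D * h)\<^sup>2"
        using S3_taylor[of "D * h" "D * x"] \<open>D > 0\<close> h by (simp add: distrib_left)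
      from divide_right_mono[OF this, of "D ^ 2"]
      show ?thesis unfolding u_def D_def[symmetric] using \<open>D > 0\<close>
        by (simp add: diff_divide_distrib power_mult_distrib) (simp add: power2_eq_square)
    qed
    \<comment> \<open>Replacing \<open>1 / (d + 1)^2\<close> by \<open>1 / d - 1 / (d + 1)\<close>
      makes the bound on the tail telescope.\<close>
    have tail: "u d \<ge> - 2 * M * (1 / real d - 1 / real (Suc d))" if "d > 0" for d
    proof -
      have "- (2 * M) / real (Suc d) ^ 2 \<le> u d"
        unfolding u_def using M[of "real (Suc d) * (x + h)"] M[of "real (Suc d) * x"]
        by (intro divide_right_mono) (auto simp: abs_le_iff)
      moreover have "2 * M * (1 / real (Suc d) ^ 2) \<le> 2 * M * (1 / real d - 1 / real (Suc d))"
      proof (rule mult_left_mono)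
        have "1 / real (Suc d) ^ 2 \<le> 1 / (real d * real (Suc d))"
          unfolding power2_eq_square using that by (intro divide_left_mono mult_right_mono) auto
        also have "\<dots> = 1 / real d - 1 / real (Suc d)"
          using that by (simp add: field_simps)
        finally show "1 / real (Suc d) ^ 2 \<le> 1 / real d - 1 / real (Suc d)" .
      qed (use M0 in simp)
      ultimately show ?thesis by simp
    qed
    have partial: "(\<Sum>d<n. u d) \<ge> (\<Sum>d<N. u d) - 2 * M * (1 / real N - 1 / real n)" if "n \<ge> N" for n
      using that
    proof (induction n rule: dec_induct)
      case (step n)
      then show ?case using tail[of n] \<open>N > 0\<close> by (simp add: algebra_simps)
    qed simp
    have "F2 (x + h) - F2 x \<ge> (\<Sum>d<N. u d) - 2 * M * h"
    proof (rule LIMSEQ_le_const[OF u_sums[unfolded sums_def]], intro exI allI impI)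
      fix n assume "n \<ge> N"
      have "0 \<le> 2 * M * (1 / real n)" using M0 by simp
      with partial[OF \<open>n \<ge> N\<close>] show "(\<Sum>d<N. u d) - 2 * M * h \<le> (\<Sum>d<n. u d)"
        by (simp add: h_def right_diff_distrib)
    qed
    moreover have "(\<Sum>d<N. u d) \<ge> (\<Sum>d<N. 2 * pi * h * (C2 (real (Suc d) * x) / real (Suc d)) - 4 * pi ^ 3 * h\<^sup>2)"
      by (intro sum_mono head)
    ultimately have "F2 (x + h) - F2 x \<ge>
        2 * pi * h * (\<Sum>d<N. C2 (real (Suc d) * x) / real (Suc d)) - real N * (4 * pi ^ 3 * h\<^sup>2) - 2 * M * h"
      by (simp add: sum_subtractf sum_distrib_left)
    then have "real N * (F2 (x + h) - F2 x) \<ge> real N *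
        (2 * pi * h * (\<Sum>d<N. C2 (real (Suc d) * x) / real (Suc d)) - real N * (4 * pi ^ 3 * h\<^sup>2) - 2 * M * h)"
      by (rule mult_left_mono) simp
    also have "real N * (2 * pi * h * T - real N * (4 * pi ^ 3 * h\<^sup>2) - 2 * M * h) = 2 * pi * T - (4 * pi ^ 3 + 2 * M)" for T
      using that by (simp add: h_def field_simps power2_eq_square)
    finally show ?thesis by (simp add: h_def)
  qed
  then show ?thesis by (intro exI allI impI)
qed

section \<open>Divergence for periodic coefficients of positive mean\<close>

text \<open>Over the \<open>k\<close>-th period the sum is at least \<open>A / (q * (k + 1))\<close>
  up to a summable error, where \<open>A > 0\<close> is the sum over one period. Bounded partial
  sums would make the harmonic series converge.\<close>

lemma periodic_positive_mean_series_unbounded: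
  fixes c :: "nat \<Rightarrow> real"
  assumes period: "\<And>d. c (d + q) = c d" and mean: "(\<Sum>d<q. c d) > 0"
  shows "\<exists>N>0. (\<Sum>d<N. c d / real (Suc d)) > B"
proof (rule ccontr)
  assume "\<not> ?thesis"
  \<comment> \<open>The maximum with 0 accounts for the empty sum, which the negated claim leaves
    open.\<close>
  then have B: "(\<Sum>d<N. c d / real (Suc d)) \<le> max B 0" for N
    by (cases "N = 0") (simp, meson le_max_iff_disj not_gr_zero not_less)
  have "q > 0" using mean by (auto intro: Nat.gr0I)
  define A where "A = (\<Sum>d<q. c d)"
  define C where "C = (\<Sum>d<q. \<bar>c d\<bar>)"
  have period': "c (k * q + d) = c d" for k d
  proof (induction k)
    case (Suc k)
    then show ?case using period[of "k * q + d"] by (simp add: add_ac)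
  qed simp
  have block: "(\<Sum>d\<in>{k * q..<k * q + q}. c d / real (Suc d)) \<ge> A / real q * (1 / real (Suc k)) - C * (1 / real (Suc k) ^ 2)" for k
  proof -
    have "(\<Sum>d\<in>{k * q..<k * q + q}. c d / real (Suc d)) = (\<Sum>j<q. c j / real (Suc (k * q + j)))"
      using sum.shift_bounds_nat_ivl[of "\<lambda>d. c d / real (Suc d)" 0 "k * q" q]
      by (simp add: period' atLeast0LessThan add.commute[of _ "k * q"] add.commute[of q])
    also have "\<dots> \<ge> (\<Sum>j<q. c j * (1 / (real q * real (Suc k))) - \<bar>c j\<bar> * (1 / real (Suc k) ^ 2))"
    proof (rule sum_mono)
      fix j assume "j \<in> {..<q}"
      then have j: "real j + 1 \<le> real q" by (simp add: Suc_le_eq[symmetric] del: of_nat_Suc flip: of_nat_Suc)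
      \<comment> \<open>The excess of a weight over the last weight of its period,
        \<open>1 / (q * (k + 1))\<close>. It lies between 0 and
        \<open>1 / (k + 1)^2\<close>.\<close>
      define w where "w = 1 / real (Suc (k * q + j)) - 1 / (real q * real (Suc k))"
      have le1: "real (Suc k) \<le> real (Suc (k * q + j))"
        unfolding of_nat_le_iff using \<open>q > 0\<close> by (simp add: trans_le_add1)
      have weq: "w = (real q * real (Suc k) - real (Suc (k * q + j))) / (real (Suc (k * q + j)) * (real q * real (Suc k)))"
        unfolding w_def using \<open>q > 0\<close> by (subst diff_frac_eq) (auto simp del: of_nat_Suc)
      have num: "real q * real (Suc k) - real (Suc (k * q + j)) = real q - (real j + 1)"
        by (simp add: algebra_simps)
      have "w \<ge> 0" unfolding weq num using j by (intro divide_nonneg_nonneg) auto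
      have "w \<le> real q / (real (Suc (k * q + j)) * (real q * real (Suc k)))"
        unfolding weq num by (intro divide_right_mono) auto
      also have "\<dots> = 1 / (real (Suc (k * q + j)) * real (Suc k))"
        using \<open>q > 0\<close> by (simp add: field_simps del: of_nat_Suc)
      also have "\<dots> \<le> 1 / real (Suc k) ^ 2"
        unfolding power2_eq_square using le1 by (intro divide_left_mono mult_right_mono) (auto simp del: of_nat_Suc)
      finally have "\<bar>w\<bar> \<le> 1 / real (Suc k) ^ 2" using \<open>w \<ge> 0\<close> by simp
      then have "\<bar>c j * w\<bar> \<le> \<bar>c j\<bar> * (1 / real (Suc k) ^ 2)"
        unfolding abs_mult by (intro mult_left_mono) auto
      moreover have "c j / real (Suc (k * q + j)) = c j * (1 / (real q * real (Suc k))) + c j * w"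
        by (simp add: w_def algebra_simps)
      ultimately show "c j * (1 / (real q * real (Suc k))) - \<bar>c j\<bar> * (1 / real (Suc k) ^ 2) \<le> c j / real (Suc (k * q + j))"
        by linarith
    qed
    also have "(\<Sum>j<q. c j * (1 / (real q * real (Suc k))) - \<bar>c j\<bar> * (1 / real (Suc k) ^ 2)) =
        A / real q * (1 / real (Suc k)) - C * (1 / real (Suc k) ^ 2)"
      unfolding sum_subtractf sum_distrib_right[symmetric] A_def C_def by simp
    finally show ?thesis .
  qed
  have s2: "summable (\<lambda>k. C * (1 / real (Suc k) ^ 2))"
    by (intro summable_mult summable_inverse_Suc_power) simp
  have "A > 0" "C \<ge> 0" using mean by (auto simp: A_def C_def intro: sum_nonneg)
  have "summable (\<lambda>k. A / real q * (1 / real (Suc k)))"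
  proof (rule summableI_nonneg_bounded)
    show "0 \<le> A / real q * (1 / real (Suc k))" for k using \<open>A > 0\<close> by simp
    fix n
    have "(\<Sum>k<n. A / real q * (1 / real (Suc k))) - (\<Sum>k<n. C * (1 / real (Suc k) ^ 2))
        \<le> (\<Sum>k<n. \<Sum>d\<in>{k * q..<k * q + q}. c d / real (Suc d))"
      unfolding sum_subtractf[symmetric] by (intro sum_mono block)
    also have "\<dots> = (\<Sum>d<n * q. c d / real (Suc d))" by (rule sum.nat_group)
    also have "\<dots> \<le> max B 0" by (rule B)
    finally have "(\<Sum>k<n. A / real q * (1 / real (Suc k))) - (\<Sum>k<n. C * (1 / real (Suc k) ^ 2)) \<le> max B 0" .
    moreover have "(\<Sum>k<n. C * (1 / real (Suc k) ^ 2)) \<le> (\<Sum>k. C * (1 / real (Suc k) ^ 2))"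
      using s2 \<open>C \<ge> 0\<close> by (intro sum_le_suminf) auto
    ultimately show "(\<Sum>k<n. A / real q * (1 / real (Suc k))) \<le> max B 0 + (\<Sum>k. C * (1 / real (Suc k) ^ 2))"
      by simp
  qed
  from summable_mult[OF this, of "real q / A"] have "summable (\<lambda>k. inverse (real (Suc k)))"
    using \<open>A > 0\<close> \<open>q > 0\<close> by (simp add: inverse_eq_divide del: of_nat_Suc)
  then show False
    using not_summable_harmonic[where 'a = real] summable_Suc_iff[of "\<lambda>n. inverse (real n)"] by blast
qed

section \<open>Positivity of the mean of \<open>C2\<close> over a period\<close>

text \<open>Real part of a geometric sum of powers of \<open>w\<close> with \<open>w^q = 1\<close>:
  it equals \<open>q\<close> if \<open>w = 1\<close> and vanishes otherwise.\<close>

lemma sum_cos_nonneg: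
  assumes "real q * t = of_int p"
  shows "(\<Sum>j<q. cos (2 * pi * t * real (Suc j))) \<ge> 0"
proof -
  let ?w = "cis (2 * pi * t)"
  have "?w ^ q = cis (2 * pi * of_int p)"
    unfolding Complex.DeMoivre assms[symmetric] by (simp add: mult_ac)
  then have wq: "?w ^ q = 1" by (simp add: cis_multiple_2pi)
  have "(\<Sum>j<q. cos (2 * pi * t * real (Suc j))) = Re (\<Sum>j<q. ?w ^ Suc j)"
    by (simp add: Complex.DeMoivre mult_ac del: power_Suc of_nat_Suc)
  also have "(\<Sum>j<q. ?w ^ Suc j) = ?w * (\<Sum>j<q. ?w ^ j)"
    by (simp add: sum_distrib_left)
  also have "\<dots> = (if ?w = 1 then of_nat q else 0)"
    using wq by (simp add: sum_gp_strict)
  also have "Re \<dots> \<ge> 0" by simp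
  finally show ?thesis .
qed

text \<open>Summing over \<open>d\<close> first, the coefficient of each \<open>1 / n^2\<close> is
  nonnegative by \<open>sum_cos_nonneg\<close>. At the frequency \<open>n = Suc q\<close>, index
  \<open>q\<close> of the series, all cosines are 1, so that term is positive.\<close>

lemma C2_mean_positive:
  assumes "real (Suc q) * x = of_int p"
  shows "(\<Sum>d<Suc q. C2 (real (Suc d) * x)) > 0"
proof -
  let ?a = "\<lambda>n. (\<Sum>d<Suc q. cos (2 * pi * (real (Suc n) * x) * real (Suc d))) / real (Suc n) ^ 2"
  have "(\<lambda>n. \<Sum>d<Suc q. cos (2 * pi * real (Suc n) * (real (Suc d) * x)) / real (Suc n) ^ 2) sums
      (\<Sum>d<Suc q. C2 (real (Suc d) * x))"
    unfolding C2_def by (intro sums_sum summable_sums summable_C2)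
  then have sums: "?a sums (\<Sum>d<Suc q. C2 (real (Suc d) * x))"
    by (simp only: sum_divide_distrib mult_ac)
  have "0 < suminf ?a"
  proof (rule suminf_pos2)
    show "summable ?a" using sums by (rule sums_summable)
    show "0 \<le> ?a n" for n
    proof (intro divide_nonneg_nonneg sum_cos_nonneg)
      show "real (Suc q) * (real (Suc n) * x) = of_int (int (Suc n) * p)"
        using assms by (simp add: mult_ac)
    qed simp
    have "cos (2 * pi * (real (Suc q) * x) * real (Suc d)) = 1" for d
      unfolding assms using cos_int_2pin[of "p * int (Suc d)"] by (simp add: mult_ac)
    then have "(\<Sum>d<Suc q. cos (2 * pi * (real (Suc q) * x) * real (Suc d))) = real (Suc q)" by simp
    then show "0 < ?a q" by simp
  qed
  then show ?thesis using sums by (simp add: sums_iff)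
qed

section \<open>Non-differentiability of \<open>F2\<close> at rationals\<close>

lemma F2_not_differentiable:
  assumes "x \<in> \<rat>"
  shows "\<not> F2 differentiable at x"
proof
  assume "F2 differentiable at x"
  then obtain D where "(F2 has_real_derivative D) (at x)"
    by (auto simp: real_differentiable_def)
  then have "((\<lambda>h. (F2 (x + h) - F2 x) / h) \<longlongrightarrow> D) (at 0)" by (simp add: DERIV_def)
  moreover have "filterlim (\<lambda>n. 1 / real (Suc n)) (at 0) sequentially"
    using LIMSEQ_inverse_real_of_nat by (auto simp: filterlim_at inverse_eq_divide simp del: of_nat_Suc)
  ultimately have "(\<lambda>n. (F2 (x + 1 / real (Suc n)) - F2 x) / (1 / real (Suc n))) \<longlonglongrightarrow> D"
    by (rule filterlim_compose)
  then have "(\<lambda>n. real (Suc n) * (F2 (x + 1 / real (Suc n)) - F2 x)) \<longlonglongrightarrow> D" by (simp add: mult.commute)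
  then have "Bseq (\<lambda>n. real (Suc n) * (F2 (x + 1 / real (Suc n)) - F2 x))"
    by (rule convergent_imp_Bseq[OF convergentI])
  then obtain B where B: "\<forall>n. norm (real (Suc n) * (F2 (x + 1 / real (Suc n)) - F2 x)) \<le> B"
    by (rule BseqE)
  obtain K where K: "\<forall>x. \<forall>N>0.
    real N * (F2 (x + 1 / real N) - F2 x) \<ge> 2 * pi * (\<Sum>d<N. C2 (real (Suc d) * x) / real (Suc d)) - K"
    using F2_quotient_lower_bound by (rule exE)
  obtain q p where q: "real (Suc q) * x = of_int p" using Rats_denominator[OF assms] .
  have "C2 (real (Suc (d + Suc q)) * x) = C2 (real (Suc d) * x)" for d
  proof -
    have "real (Suc (d + Suc q)) * x = real (Suc d) * x + of_int p"
      unfolding q[symmetric] by (simp add: algebra_simps)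
    then show ?thesis by (simp only: C2_add_int)
  qed
  \<comment> \<open>The threshold is chosen so that the lower bound, after subtracting
    \<open>K\<close>, exceeds the bound \<open>B\<close> forced by differentiability.\<close>
  from periodic_positive_mean_series_unbounded[of "\<lambda>d. C2 (real (Suc d) * x)", OF this C2_mean_positive[OF q]]
  obtain N where N: "N > 0" "(\<Sum>d<N. C2 (real (Suc d) * x) / real (Suc d)) > (B + K) / (2 * pi)" by blast
  then have "2 * pi * (\<Sum>d<N. C2 (real (Suc d) * x) / real (Suc d)) > B + K"
    by (simp add: field_simps)
  moreover have "real N * (F2 (x + 1 / real N) - F2 x) \<le> B"
    using B[rule_format, of "N - 1"] \<open>N > 0\<close> by simp
  ultimately show False using K[rule_format, OF \<open>N > 0\<close>, of x] by linarith
qed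

theorem theorem1p1:
  shows "(\<forall>x\<in>\<rat>. \<not> F2 differentiable at x \<and> \<not> G2 differentiable at x)
    \<and> (\<forall>x\<in>\<rat>. G2 differentiable at_right x \<and> G2 differentiable at_left x)"
  using F2_not_differentiable G2_not_differentiable
    G2_right_deriv(2)[THEN has_field_derivative_imp_has_derivative, THEN differentiableI]
    G2_left_deriv(2)[THEN has_field_derivative_imp_has_derivative, THEN differentiableI] by blast

end
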